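(* Let $Q\in\mathbb{R}^{n\times n}$ be a symmetric matrix with smallest eigenvalue $\lambda_1(Q)$, let $q\in\mathbb{R}^n$, and let $C\subset\mathbb{R}^n$ be a nonempty closed convex set. For any $x^0\in C$, any $\rho>0$ with $\rho>-\lambda_1(Q)$, and any $\eta>0$, the trajectory $x(\cdot)$ of the dynamical system $$\dot{x}(t)=\frac{1}{\eta}\left[F_C(x(t))-x(t)\right]\quad\text{for all } t\ge 0,\qquad x(0)=x^0,$$ is contained in $C$, that is, $x(t)\in C$ for all $t\ge 0$.
   Context: For $u\in\mathbb{R}^n$, $F_C(u)$ denotes the unique solution of the strongly convex problem $$\min\Big\{\tfrac{1}{2}x^TQx+q^Tx+\tfrac{\rho}{2}\|x-u\|^2 \;\Big|\; x\in C\Big\},$$ where $\|\cdot\|$ is the Euclidean norm (strong convexity holds because $\rho>-\lambda_1(Q)$). The trajectory is the unique $C^1$ solution of the stated initial value problem. *)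

theory Defs
  imports "HOL-Analysis.Analysis"
begin

definition eigenvalues :: "real ^ 'n ^ 'n \<Rightarrow> real set" where
  "eigenvalues Q = {l. \<exists>v. v \<noteq> 0 \<and> Q *v v = l *\<^sub>R v}"

(* Intended for symmetric Q, where the set of real eigenvalues is finite and nonempty. *)
definition lambda_min :: "real ^ 'n ^ 'n \<Rightarrow> real" where
  "lambda_min Q = Min (eigenvalues Q)"

definition prox_objective ::
    "real ^ 'n ^ 'n \<Rightarrow> real ^ 'n \<Rightarrow> real \<Rightarrow> real ^ 'n \<Rightarrow> real ^ 'n \<Rightarrow> real" where
  "prox_objective Q q \<rho> u x =
     1 / 2 * (x \<bullet> (Q *v x)) + q \<bullet> x + \<rho> / 2 * (norm (x - u))\<^sup>2"

(* The map F_C. The definite description is meaningful because the objective is strongly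
   convex whenever \<rho> > - lambda_min Q, so the minimizer over a nonempty closed convex set
   exists and is unique. *)
definition prox_solution ::
    "real ^ 'n ^ 'n \<Rightarrow> real ^ 'n \<Rightarrow> real \<Rightarrow> (real ^ 'n) set \<Rightarrow> real ^ 'n \<Rightarrow> real ^ 'n" where
  "prox_solution Q q \<rho> C u =
     (THE x. is_arg_min (prox_objective Q q \<rho> u) (\<lambda>y. y \<in> C) x)"

(* C^1 solutions on the half-line: the derivative is taken within {0..}, hence one-sided at 0,
   so values of x at negative times are irrelevant. *)
definition is_trajectory ::
    "real ^ 'n ^ 'n \<Rightarrow> real ^ 'n \<Rightarrow> real \<Rightarrow> (real ^ 'n) set \<Rightarrow> real \<Rightarrow> real ^ 'n \<Rightarrow>
     (real \<Rightarrow> real ^ 'n) \<Rightarrow> bool" where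
  "is_trajectory Q q \<rho> C \<eta> x0 x \<longleftrightarrow>
     x 0 = x0 \<and>
     (\<exists>x'. continuous_on {0..} x' \<and>
           (\<forall>t\<ge>0. (x has_vector_derivative x' t) (at t within {0..}) \<and>
                   x' t = (1 / \<eta>) *\<^sub>R (prox_solution Q q \<rho> C (x t) - x t)))"

end

(* F_C takes values in C, so along the trajectory an affine functional a . x - b that is positive
   on C satisfies (exp (t / eta) (a . x - b))' > 0 and hence stays positive once it starts positive.
   A point of the trajectory outside C would be separated from C by such a functional.
   That F_C is well defined reduces to v . Qv >= lambda_min Q |v|^2, which holds because a
   minimiser of the Rayleigh quotient on the unit sphere is an eigenvector. *)

theory Submission
  imports Defs
begin

lemma symmetric_matrix_inner:
  fixes Q :: "real ^ 'n ^ 'n"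
  assumes "transpose Q = Q"
  shows "(Q *v v) \<bullet> w = v \<bullet> (Q *v w)"
  by (metis assms dot_lmul_matrix transpose_matrix_vector)

text \<open>\<open>lambda_min\<close> is a \<open>Min\<close>, which bounds its elements only over a
  finite set. Eigenvectors for distinct eigenvalues of a symmetric matrix are orthogonal, hence
  independent, and independent sets here are finite.\<close>

lemma finite_eigenvalues_symmetric:
  fixes Q :: "real ^ 'n ^ 'n"
  assumes sym: "transpose Q = Q"
  shows "finite (eigenvalues Q)"
proof -
  have "\<forall>l\<in>eigenvalues Q. \<exists>v. v \<noteq> 0 \<and> Q *v v = l *\<^sub>R v"
    by (auto simp: eigenvalues_def)
  then obtain e where e: "\<And>l. l \<in> eigenvalues Q \<Longrightarrow> e l \<noteq> 0 \<and> Q *v e l = l *\<^sub>R e l"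
    by metis
  have orth: "e l \<bullet> e m = 0" if "l \<in> eigenvalues Q" "m \<in> eigenvalues Q" "l \<noteq> m" for l m
    using symmetric_matrix_inner[OF sym, of "e l" "e m"] e that by simp
  have "inj_on e (eigenvalues Q)"
    using orth e by (metis inj_onI inner_eq_zero_iff)
  moreover have "pairwise orthogonal (e ` eigenvalues Q)"
    using orth by (auto simp: pairwise_def orthogonal_def)
  then have "independent (e ` eigenvalues Q)"
    using e by (intro pairwise_orthogonal_independent) auto
  then have "finite (e ` eigenvalues Q)"
    by (rule independent_imp_finite)
  ultimately show ?thesis
    using finite_imageD by blast
qed

text \<open>A zero of a nonnegative form is a minimum, so the gradient 2 \<open>B *v v\<close>
  vanishes there. Otherwise a small step from \<open>v\<close> against the gradient would make the
  form negative.\<close>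

lemma psd_kernel:
  fixes B :: "real ^ 'n ^ 'n"
  assumes sym: "transpose B = B"
    and psd: "\<And>w. w \<bullet> (B *v w) \<ge> 0"
    and v: "v \<bullet> (B *v v) = 0"
  shows "B *v v = 0"
proof (rule ccontr)
  assume nz: "B *v v \<noteq> 0"
  define w where "w = B *v v"
  define N where "N = w \<bullet> w"
  define K where "K = w \<bullet> (B *v w)"
  \<comment> \<open>The form at \<open>v - t *\<^sub>R w\<close> equals t (t K - 2 N), so any t > 0
    with t K < 2 N gives a contradiction. Here t K = N - t; the + 1 covers the case K = 0.\<close>
  define t where "t = N / (K + 1)"
  have N: "N > 0" using nz by (simp add: N_def w_def)
  have K: "K \<ge> 0" using psd by (simp add: K_def)
  have t: "t > 0" using N K by (simp add: t_def)
  have vBw: "v \<bullet> (B *v w) = N"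
    using symmetric_matrix_inner[OF sym, of v w] by (simp add: N_def w_def)
  have "(v - t *\<^sub>R w) \<bullet> (B *v (v - t *\<^sub>R w))
      = v \<bullet> (B *v v) - t * (v \<bullet> (B *v w)) - t * (w \<bullet> (B *v v)) + t * (t * K)"
    by (simp add: matrix_vector_mult_diff_distrib matrix_vector_mult_scaleR inner_diff_left
        inner_diff_right K_def algebra_simps)
  also have "\<dots> = t * (t * K - 2 * N)"
    using v vBw by (simp add: N_def w_def algebra_simps)
  finally have "t * (t * K - 2 * N) \<ge> 0" using psd by metis
  then have "t * K \<ge> 2 * N" using t by (simp add: zero_le_mult_iff)
  moreover have "t * (K + 1) = N" using K by (simp add: t_def)
  then have "t * K + t = N" by (simp add: distrib_left)
  ultimately show False using N t by linarith
qed

lemma lambda_min_le_quadratic_form: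
  fixes Q :: "real ^ 'n ^ 'n"
  assumes sym: "transpose Q = Q"
  shows "lambda_min Q * (norm w)\<^sup>2 \<le> w \<bullet> (Q *v w)"
proof -
  have "continuous_on (sphere 0 1) (\<lambda>v. v \<bullet> (Q *v v))"
    by (intro continuous_intros)
  \<comment> \<open>Any unit vector would do; it shows that the sphere is nonempty.\<close>
  moreover have "(axis undefined 1 :: real ^ 'n) \<in> sphere 0 1"
    by simp
  ultimately obtain v :: "real ^ 'n" where v: "norm v = 1"
    and min: "\<And>y. norm y = 1 \<Longrightarrow> v \<bullet> (Q *v v) \<le> y \<bullet> (Q *v y)"
    using continuous_attains_inf[of "sphere 0 1" "\<lambda>v::real ^ 'n. v \<bullet> (Q *v v)"]
    by (metis compact_sphere empty_iff mem_sphere_0)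
  define m where "m = v \<bullet> (Q *v v)"
  \<comment> \<open>The shift makes the form nonnegative and zero at \<open>v\<close>, so
    \<open>psd_kernel\<close> turns the minimiser into an eigenvector without Lagrange
    multipliers.\<close>
  define B where "B = Q - m *\<^sub>R mat 1"
  have Bmult: "B *v y = Q *v y - m *\<^sub>R y" for y
    by (simp add: B_def matrix_vector_mult_diff_rdistrib scaleR_matrix_vector_assoc[symmetric])
  have ray: "m * (norm y)\<^sup>2 \<le> y \<bullet> (Q *v y)" for y
  proof (cases "y = 0")
    case False
    have "m \<le> (y /\<^sub>R norm y) \<bullet> (Q *v (y /\<^sub>R norm y))"
      unfolding m_def using False by (intro min) simp
    also have "\<dots> = (y \<bullet> (Q *v y)) / (norm y)\<^sup>2"
      by (simp add: matrix_vector_mult_scaleR divide_simps power2_eq_square)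
    finally show ?thesis using False by (simp add: pos_le_divide_eq)
  qed simp
  have "transpose B = B"
    using sym by (simp add: B_def vec_eq_iff transpose_def mat_def)
  moreover have "y \<bullet> (B *v y) \<ge> 0" for y
    using ray[of y] by (simp add: Bmult inner_diff_right power2_norm_eq_inner)
  moreover have "v \<bullet> (B *v v) = 0"
    using v by (simp add: Bmult inner_diff_right m_def flip: power2_norm_eq_inner)
  ultimately have "B *v v = 0"
    by (rule psd_kernel)
  then have "m \<in> eigenvalues Q"
    using v by (auto simp: Bmult eigenvalues_def intro!: exI[of _ v])
  then have "lambda_min Q \<le> m"
    unfolding lambda_min_def by (intro Min_le finite_eigenvalues_symmetric sym)
  then show ?thesis
    using ray[of w] by (meson mult_right_mono order_trans zero_le_power2)
qed

text \<open>The second-order Taylor expansion is exact because the objective is quadratic; symmetry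
  of \<open>Q\<close> merges the two cross terms into the gradient term.\<close>

lemma prox_objective_expansion:
  fixes Q :: "real ^ 'n ^ 'n"
  assumes sym: "transpose Q = Q"
  shows "prox_objective Q q \<rho> u (z + d) = prox_objective Q q \<rho> u z
    + (Q *v z + q + \<rho> *\<^sub>R (z - u)) \<bullet> d + 1 / 2 * (d \<bullet> (Q *v d) + \<rho> * (norm d)\<^sup>2)"
  using symmetric_matrix_inner[OF sym, of z d]
  by (simp add: prox_objective_def matrix_vector_right_distrib power2_norm_eq_inner
      inner_simps inner_commute algebra_simps add_divide_distrib)

text \<open>Used twice below: at a point of \<open>C\<close> it gives coercivity, and at a midpoint
  of two minimisers it gives uniqueness.\<close>

lemma prox_objective_strongly_convex:
  fixes Q :: "real ^ 'n ^ 'n"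
  assumes "transpose Q = Q"
  shows "prox_objective Q q \<rho> u (z + d) \<ge> prox_objective Q q \<rho> u z
    + (Q *v z + q + \<rho> *\<^sub>R (z - u)) \<bullet> d + (lambda_min Q + \<rho>) / 2 * (norm d)\<^sup>2"
  using lambda_min_le_quadratic_form[OF assms, of d]
  unfolding prox_objective_expansion[OF assms] by (simp add: field_simps)

text \<open>The definite description carries information only once a minimiser is known to exist and
  to be unique, so both are proved here.\<close>

lemma prox_solution_in:
  fixes Q :: "real ^ 'n ^ 'n"
  assumes sym: "transpose Q = Q" and C: "C \<noteq> {}" "closed C" "convex C"
    and \<rho>: "\<rho> > - lambda_min Q"
  shows "prox_solution Q q \<rho> C u \<in> C"
proof -
  let ?f = "prox_objective Q q \<rho> u"
  define c where "c = lambda_min Q + \<rho>"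
  have c: "c > 0" using \<rho> by (simp add: c_def)
  note strong = prox_objective_strongly_convex[OF sym, of q \<rho> u, folded c_def]
  obtain y0 where y0: "y0 \<in> C" using C by blast
  define g where "g = Q *v y0 + q + \<rho> *\<^sub>R (y0 - u)"
  \<comment> \<open>At distance r from \<open>y0\<close> the linear term loses at most r
    \<open>norm g\<close> and the quadratic one gains c r^2 / 2. The gain wins exactly when r >
    R.\<close>
  define R where "R = 2 * norm g / c"
  have R: "R \<ge> 0" using c by (simp add: R_def)
  have outside: "?f y0 < ?f y" if "norm (y - y0) > R" for y
  proof -
    have "norm g < c / 2 * norm (y - y0)"
      using that c by (simp add: R_def field_simps)
    then have "norm g * norm (y - y0) < c / 2 * norm (y - y0) * norm (y - y0)"
      using that R by (intro mult_strict_right_mono) auto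
    moreover have "- (norm g * norm (y - y0)) \<le> g \<bullet> (y - y0)"
      using Cauchy_Schwarz_ineq2[of g "y - y0"] by linarith
    ultimately show ?thesis
      using strong[of y0 "y - y0"] by (simp add: g_def power2_eq_square)
  qed
  have "continuous_on (C \<inter> cball y0 R) ?f"
    unfolding prox_objective_def by (intro continuous_intros)
  moreover have "compact (C \<inter> cball y0 R)" "C \<inter> cball y0 R \<noteq> {}"
    using C y0 R by (auto simp: closed_Int_compact)
  ultimately obtain z where z: "z \<in> C \<inter> cball y0 R"
    and zmin: "\<And>y. y \<in> C \<inter> cball y0 R \<Longrightarrow> ?f z \<le> ?f y"
    by (metis continuous_attains_inf)
  \<comment> \<open>The minimum over the compact piece is global on \<open>C\<close>: points outside
    the ball are already worse than \<open>y0\<close>, which lies in the piece.\<close>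
  have "?f z \<le> ?f y" if "y \<in> C" for y
  proof (cases "y \<in> cball y0 R")
    case False
    then have "?f y0 < ?f y" by (intro outside) (simp add: dist_norm norm_minus_commute)
    moreover have "?f z \<le> ?f y0" using zmin y0 R by simp
    ultimately show ?thesis by simp
  qed (use that zmin in simp)
  then have ex: "is_arg_min ?f (\<lambda>y. y \<in> C) z"
    using z by (simp add: is_arg_min_linorder)
  have uniq: "a = b" if a: "is_arg_min ?f (\<lambda>y. y \<in> C) a" and b: "is_arg_min ?f (\<lambda>y. y \<in> C) b"
    for a b
  proof (rule ccontr)
    assume "a \<noteq> b"
    define m where "m = midpoint a b"
    define d where "d = (1 / 2) *\<^sub>R (a - b)"
    have ab: "a = m + d" "b = m + - d"
      by (simp_all add: m_def d_def midpoint_def vec_eq_iff field_simps)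
    have "m \<in> C"
      using a b closed_segment_subset[OF _ _ C(3), of a b]
      by (auto simp: m_def is_arg_min_def)
    then have "?f (m + d) \<le> ?f m" "?f (m + - d) \<le> ?f m"
      using a b unfolding ab by (auto simp: is_arg_min_linorder)
    \<comment> \<open>Strong convexity at the midpoint in the directions \<open>d\<close> and
      \<open>- d\<close>: the gradient terms cancel when the two inequalities are added.\<close>
    then have "c * (norm d)\<^sup>2 \<le> 0"
      using strong[of m d] strong[of m "- d"] by simp
    then have "d = 0" using c by (simp add: mult_le_0_iff)
    with \<open>a \<noteq> b\<close> show False by (simp add: d_def)
  qed
  have "prox_solution Q q \<rho> C u = z"
    unfolding prox_solution_def using ex uniq by (intro the_equality) auto
  then show ?thesis using z by simp
qed

text \<open>The velocity always points towards a point of \<open>C\<close>. An arbitrary curve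
  \<open>y\<close> in \<open>C\<close> replaces F_C, which enters only through its values.\<close>

lemma relaxation_flow_in_closed_convex:
  fixes x y :: "real \<Rightarrow> 'a :: euclidean_space"
  assumes C: "closed C" "convex C" and x0: "x 0 \<in> C"
    and y: "\<And>t. t \<ge> 0 \<Longrightarrow> y t \<in> C" and k: "k > 0"
    and deriv: "\<And>t. t \<ge> 0 \<Longrightarrow> (x has_vector_derivative k *\<^sub>R (y t - x t)) (at t within {0..})"
    and t: "t \<ge> 0"
  shows "x t \<in> C"
proof (rule ccontr)
  assume "x t \<notin> C"
  then obtain a b where ab: "a \<bullet> x t < b" "\<And>z. z \<in> C \<Longrightarrow> a \<bullet> z > b"
    using separating_hyperplane_closed_point[OF C(2,1)] by blast
  \<comment> \<open>The integrating factor cancels the term -k (a . x - b), so the derivative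
    involves only \<open>y\<close>, whose position relative to the hyperplane is known.\<close>
  define g where "g s = exp (k * s) * (a \<bullet> x s - b)" for s
  have g': "(g has_real_derivative exp (k * s) * k * (a \<bullet> y s - b)) (at s within {0..t})"
    if "s \<ge> 0" for s
  proof -
    have "(x has_vector_derivative k *\<^sub>R (y s - x s)) (at s within {0..t})"
      using deriv[OF that] by (rule has_vector_derivative_within_subset) auto
    then have "((\<lambda>s. a \<bullet> x s) has_real_derivative a \<bullet> (k *\<^sub>R (y s - x s))) (at s within {0..t})"
      unfolding has_real_derivative_iff_has_vector_derivative
      by (rule bounded_linear.has_vector_derivative[OF bounded_linear_inner_right])
    then show ?thesis
      unfolding g_def
      by (auto intro!: derivative_eq_intros simp: inner_diff_right algebra_simps)
  qed
  \<comment> \<open>By the mean value theorem \<open>g\<close> cannot decrease from 0 to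
    \<open>t\<close>, yet the strict separation makes it positive at 0 and negative at
    \<open>t\<close>.\<close>
  obtain s where s: "s \<in> {0..t}"
    and "g t - g 0 = exp (k * s) * k * (a \<bullet> y s - b) * (t - 0)"
    using mvt_very_simple[OF t, of g "\<lambda>s. (*) (exp (k * s) * k * (a \<bullet> y s - b))"] g'
    by (auto simp: has_field_derivative_def)
  moreover have "exp (k * s) * k * (a \<bullet> y s - b) * (t - 0) \<ge> 0"
    using s k t ab(2)[OF y[of s]] by simp
  ultimately have "g 0 \<le> g t" by linarith
  moreover have "g 0 > 0" using ab(2)[OF x0] by (simp add: g_def)
  moreover have "g t < 0" using ab(1) by (simp add: g_def mult_pos_neg)
  ultimately show False by linarith
qed

theorem theorem2p4:
  fixes Q :: "real ^ 'n ^ 'n" and q x0 :: "real ^ 'n" and C :: "(real ^ 'n) set"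
    and \<rho> \<eta> :: real and x :: "real \<Rightarrow> real ^ 'n"
  assumes "transpose Q = Q"
    and "C \<noteq> {}" and "closed C" and "convex C"
    and "x0 \<in> C"
    and "\<rho> > 0" and "\<rho> > - lambda_min Q"
    and "\<eta> > 0"
    and "is_trajectory Q q \<rho> C \<eta> x0 x"
  shows "\<forall>t\<ge>0. x t \<in> C"
proof (intro allI impI)
  fix t :: real
  assume t: "t \<ge> 0"
  show "x t \<in> C"
  proof (rule relaxation_flow_in_closed_convex[where k = "1 / \<eta>"])
    show "prox_solution Q q \<rho> C (x s) \<in> C" for s
      using assms by (intro prox_solution_in)
    show "(x has_vector_derivative (1 / \<eta>) *\<^sub>R (prox_solution Q q \<rho> C (x s) - x s))
        (at s within {0..})" if "s \<ge> 0" for s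
      using assms(9) that unfolding is_trajectory_def by metis
  qed (use assms t in \<open>auto simp: is_trajectory_def\<close>)
qed

end
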